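(* Let $R\subseteq I\times J\times K$ be a ternary relation between sets $I,J,K$. Then $$\mathcal{D}(R)/(J,K) = \mathrm{Dowker}_I(R_{(JK)}),\qquad \mathcal{D}(R)/(I,K) = \mathrm{Dowker}_J(R_{(IK)}),\qquad \mathcal{D}(R)/(I,J) = \mathrm{Dowker}_K(R_{(IJ)})$$ as simplicial complexes on $I$, $J$, $K$ respectively.
   Context: For a set $I$, $\Delta I$ is the set of non-empty finite subsets of $I$ ordered by inclusion; a simplicial complex on $I$ is a downwardly closed subset of $\Delta I$. The Dowker relational product of $R$ is $\mathcal{D}(R)=\{(\sigma,\tau,\upsilon)\in\Delta I\times\Delta J\times\Delta K\mid\sigma\times\tau\times\upsilon\subseteq R\}$. Its iterated Dowkerian quotients are obtained by deleting two factors: $\mathcal{D}(R)/(J,K)=\{\sigma\mid(\sigma,\tau,\upsilon)\in\mathcal{D}(R)\text{ for some }\tau,\upsilon\}$, $\mathcal{D}(R)/(I,K)=\{\tau\mid(\sigma,\tau,\upsilon)\in\mathcal{D}(R)\text{ for some }\sigma,\upsilon\}$, $\mathcal{D}(R)/(I,J)=\{\upsilon\mid(\sigma,\tau,\upsilon)\in\mathcal{D}(R)\text{ for some }\sigma,\tau\}$. The rebracketed binary relations are $R_{(JK)}=\{(i,(j,k))\mid(i,j,k)\in R\}\subseteq I\times(J\times K)$, $R_{(IK)}=\{(j,(i,k))\mid(i,j,k)\in R\}\subseteq J\times(I\times K)$, $R_{(IJ)}=\{(k,(i,j))\mid(i,j,k)\in R\}\subseteq K\times(I\times J)$. For a binary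 relation $Q\subseteq A\times B$, $\mathrm{Dowker}_A(Q)=\{\sigma\in\Delta A\mid\text{there exists }b\in B\text{ such that }\sigma\times\{b\}\subseteq Q\}$. *)

theory Defs
  imports Main
begin

definition nonempty_finite_subsets :: "'a set \<Rightarrow> 'a set set" ("\<Delta>") where
  "\<Delta> A = {\<sigma>. \<sigma> \<subseteq> A \<and> finite \<sigma> \<and> \<sigma> \<noteq> {}}"

definition simplicial_complex_on :: "'a set \<Rightarrow> 'a set set \<Rightarrow> bool" where
  "simplicial_complex_on A S \<longleftrightarrow>
     S \<subseteq> \<Delta> A \<and> (\<forall>\<sigma>\<in>S. \<forall>\<rho>\<in>\<Delta> A. \<rho> \<subseteq> \<sigma> \<longrightarrow> \<rho> \<in> S)"

definition Dowker_product ::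
  "'a set \<Rightarrow> 'b set \<Rightarrow> 'c set \<Rightarrow> ('a \<times> 'b \<times> 'c) set \<Rightarrow> ('a set \<times> 'b set \<times> 'c set) set" where
  "Dowker_product I J K R =
     {(\<sigma>, \<tau>, \<upsilon>). \<sigma> \<in> \<Delta> I \<and> \<tau> \<in> \<Delta> J \<and> \<upsilon> \<in> \<Delta> K \<and> \<sigma> \<times> \<tau> \<times> \<upsilon> \<subseteq> R}"

text \<open>The quotients of a set \<open>D\<close> of triples by two of its factors; the subscript lists the
  positions of the deleted factors.\<close>

definition quotient_23 :: "('p \<times> 'q \<times> 'r) set \<Rightarrow> 'p set" where
  "quotient_23 D = {\<sigma>. \<exists>\<tau> \<upsilon>. (\<sigma>, \<tau>, \<upsilon>) \<in> D}"

definition quotient_13 :: "('p \<times> 'q \<times> 'r) set \<Rightarrow> 'q set" where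
  "quotient_13 D = {\<tau>. \<exists>\<sigma> \<upsilon>. (\<sigma>, \<tau>, \<upsilon>) \<in> D}"

definition quotient_12 :: "('p \<times> 'q \<times> 'r) set \<Rightarrow> 'r set" where
  "quotient_12 D = {\<upsilon>. \<exists>\<sigma> \<tau>. (\<sigma>, \<tau>, \<upsilon>) \<in> D}"

text \<open>Rebracketings of a ternary relation into binary ones. As tuples nest to the right,
  \<open>rebracket_23\<close> is the identity; it is kept for uniformity with the other two.\<close>

definition rebracket_23 :: "('a \<times> 'b \<times> 'c) set \<Rightarrow> ('a \<times> ('b \<times> 'c)) set" where
  "rebracket_23 R = {(i, (j, k)) | i j k. (i, j, k) \<in> R}"

definition rebracket_13 :: "('a \<times> 'b \<times> 'c) set \<Rightarrow> ('b \<times> ('a \<times> 'c)) set" where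
  "rebracket_13 R = {(j, (i, k)) | i j k. (i, j, k) \<in> R}"

definition rebracket_12 :: "('a \<times> 'b \<times> 'c) set \<Rightarrow> ('c \<times> ('a \<times> 'b)) set" where
  "rebracket_12 R = {(k, (i, j)) | i j k. (i, j, k) \<in> R}"

definition Dowker :: "'a set \<Rightarrow> 'b set \<Rightarrow> ('a \<times> 'b) set \<Rightarrow> 'a set set" where
  "Dowker A B Q = {\<sigma> \<in> \<Delta> A. \<exists>b\<in>B. \<sigma> \<times> {b} \<subseteq> Q}"

end

theory Submission
  imports Defs
begin

text \<open>Consider the quotient that keeps the first factor.
  A triple of simplices \<open>(\<sigma>, \<tau>, \<upsilon>)\<close> with \<open>\<sigma> \<times> \<tau> \<times> \<upsilon> \<subseteq> R\<close> may be shrunk in its last two factors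
  to single vertices \<open>j \<in> \<tau>\<close> and \<open>k \<in> \<upsilon>\<close>, because simplices are non-empty; and singletons are
  themselves simplices. So \<open>\<sigma>\<close> occurs in some triple of the relational product iff
  \<open>\<sigma> \<times> {(j, k)}\<close> lies in the rebracketed relation for some \<open>(j, k)\<close>, which is membership in
  the Dowker complex. The lemma \<open>ex_simplices_iff_ex_vertices\<close> isolates this exchange of two
  simplices for two vertices; it serves all three quotients, as it does not depend on which
  factor of the product is kept. The quotients inherit closure under faces from the Dowker
  complexes, where a face of \<open>\<sigma>\<close> has the same witness as \<open>\<sigma>\<close>.\<close>

text \<open>The kept factor is quantified innermost, so that the two quantifiers over the deleted
  factors face the two existential quantifiers of the quotient.\<close>

lemma
  shows triple_product_subset_iff_23: "s \<times> t \<times> u \<subseteq> R \<longleftrightarrow> (\<forall>y\<in>t. \<forall>z\<in>u. \<forall>x\<in>s. (x, y, z) \<in> R)"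
    and triple_product_subset_iff_13: "s \<times> t \<times> u \<subseteq> R \<longleftrightarrow> (\<forall>x\<in>s. \<forall>z\<in>u. \<forall>y\<in>t. (x, y, z) \<in> R)"
    and triple_product_subset_iff_12: "s \<times> t \<times> u \<subseteq> R \<longleftrightarrow> (\<forall>x\<in>s. \<forall>y\<in>t. \<forall>z\<in>u. (x, y, z) \<in> R)"
  by auto

lemma simplicial_complex_on_Dowker: "simplicial_complex_on A (Dowker A B Q)"
  unfolding simplicial_complex_on_def Dowker_def by blast

text \<open>Simplices are non-empty, so a vertex can be picked from each; conversely, singletons
  are simplices.\<close>

lemma ex_simplices_iff_ex_vertices:
  "(\<exists>\<tau>\<in>\<Delta> A. \<exists>\<upsilon>\<in>\<Delta> B. \<forall>j\<in>\<tau>. \<forall>k\<in>\<upsilon>. P j k) \<longleftrightarrow> (\<exists>j\<in>A. \<exists>k\<in>B. P j k)"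
proof
  assume "\<exists>\<tau>\<in>\<Delta> A. \<exists>\<upsilon>\<in>\<Delta> B. \<forall>j\<in>\<tau>. \<forall>k\<in>\<upsilon>. P j k"
  then show "\<exists>j\<in>A. \<exists>k\<in>B. P j k"
    unfolding nonempty_finite_subsets_def by blast
next
  assume "\<exists>j\<in>A. \<exists>k\<in>B. P j k"
  then obtain j k where "j \<in> A" "k \<in> B" "P j k" by blast
  then have "{j} \<in> \<Delta> A" "{k} \<in> \<Delta> B" "\<forall>x\<in>{j}. \<forall>y\<in>{k}. P x y"
    by (simp_all add: nonempty_finite_subsets_def)
  then show "\<exists>\<tau>\<in>\<Delta> A. \<exists>\<upsilon>\<in>\<Delta> B. \<forall>j\<in>\<tau>. \<forall>k\<in>\<upsilon>. P j k" by blast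
qed

lemma quotient_23_eq_Dowker:
  "quotient_23 (Dowker_product I J K R) = Dowker I (J \<times> K) (rebracket_23 R)"
proof (rule set_eqI)
  fix s
  have "s \<in> quotient_23 (Dowker_product I J K R) \<longleftrightarrow>
      s \<in> \<Delta> I \<and> (\<exists>t\<in>\<Delta> J. \<exists>u\<in>\<Delta> K. \<forall>y\<in>t. \<forall>z\<in>u. \<forall>x\<in>s. (x, y, z) \<in> R)"
    unfolding quotient_23_def Dowker_product_def triple_product_subset_iff_23 by auto
  also have "\<dots> \<longleftrightarrow> s \<in> \<Delta> I \<and> (\<exists>y\<in>J. \<exists>z\<in>K. \<forall>x\<in>s. (x, y, z) \<in> R)"
    by (simp only: ex_simplices_iff_ex_vertices)
  also have "\<dots> \<longleftrightarrow> s \<in> Dowker I (J \<times> K) (rebracket_23 R)"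
    unfolding Dowker_def rebracket_23_def subset_iff by auto
  finally show "s \<in> quotient_23 (Dowker_product I J K R) \<longleftrightarrow>
      s \<in> Dowker I (J \<times> K) (rebracket_23 R)" .
qed

lemma quotient_13_eq_Dowker:
  "quotient_13 (Dowker_product I J K R) = Dowker J (I \<times> K) (rebracket_13 R)"
proof (rule set_eqI)
  fix s
  have "s \<in> quotient_13 (Dowker_product I J K R) \<longleftrightarrow>
      s \<in> \<Delta> J \<and> (\<exists>t\<in>\<Delta> I. \<exists>u\<in>\<Delta> K. \<forall>y\<in>t. \<forall>z\<in>u. \<forall>x\<in>s. (y, x, z) \<in> R)"
    unfolding quotient_13_def Dowker_product_def triple_product_subset_iff_13 by auto
  also have "\<dots> \<longleftrightarrow> s \<in> \<Delta> J \<and> (\<exists>y\<in>I. \<exists>z\<in>K. \<forall>x\<in>s. (y, x, z) \<in> R)"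
    by (simp only: ex_simplices_iff_ex_vertices)
  also have "\<dots> \<longleftrightarrow> s \<in> Dowker J (I \<times> K) (rebracket_13 R)"
    unfolding Dowker_def rebracket_13_def subset_iff by auto
  finally show "s \<in> quotient_13 (Dowker_product I J K R) \<longleftrightarrow>
      s \<in> Dowker J (I \<times> K) (rebracket_13 R)" .
qed

lemma quotient_12_eq_Dowker:
  "quotient_12 (Dowker_product I J K R) = Dowker K (I \<times> J) (rebracket_12 R)"
proof (rule set_eqI)
  fix s
  have "s \<in> quotient_12 (Dowker_product I J K R) \<longleftrightarrow>
      s \<in> \<Delta> K \<and> (\<exists>t\<in>\<Delta> I. \<exists>u\<in>\<Delta> J. \<forall>y\<in>t. \<forall>z\<in>u. \<forall>x\<in>s. (y, z, x) \<in> R)"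
    unfolding quotient_12_def Dowker_product_def triple_product_subset_iff_12 by auto
  also have "\<dots> \<longleftrightarrow> s \<in> \<Delta> K \<and> (\<exists>y\<in>I. \<exists>z\<in>J. \<forall>x\<in>s. (y, z, x) \<in> R)"
    by (simp only: ex_simplices_iff_ex_vertices)
  also have "\<dots> \<longleftrightarrow> s \<in> Dowker K (I \<times> J) (rebracket_12 R)"
    unfolding Dowker_def rebracket_12_def subset_iff by auto
  finally show "s \<in> quotient_12 (Dowker_product I J K R) \<longleftrightarrow>
      s \<in> Dowker K (I \<times> J) (rebracket_12 R)" .
qed

theorem proposition6p1p1:
  fixes I :: "'a set" and J :: "'b set" and K :: "'c set"
    and R :: "('a \<times> 'b \<times> 'c) set"
  assumes "R \<subseteq> I \<times> J \<times> K"
  shows "simplicial_complex_on I (quotient_23 (Dowker_product I J K R)) \<and>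
         simplicial_complex_on I (Dowker I (J \<times> K) (rebracket_23 R)) \<and>
         quotient_23 (Dowker_product I J K R) = Dowker I (J \<times> K) (rebracket_23 R) \<and>
         simplicial_complex_on J (quotient_13 (Dowker_product I J K R)) \<and>
         simplicial_complex_on J (Dowker J (I \<times> K) (rebracket_13 R)) \<and>
         quotient_13 (Dowker_product I J K R) = Dowker J (I \<times> K) (rebracket_13 R) \<and>
         simplicial_complex_on K (quotient_12 (Dowker_product I J K R)) \<and>
         simplicial_complex_on K (Dowker K (I \<times> J) (rebracket_12 R)) \<and>
         quotient_12 (Dowker_product I J K R) = Dowker K (I \<times> J) (rebracket_12 R)"
  by (simp add: quotient_23_eq_Dowker quotient_13_eq_Dowker quotient_12_eq_Dowker
      simplicial_complex_on_Dowker)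

end
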